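(* One has $n_0(2)=3$.
   Context: For a positive integer $n$ write $[n]=\{1,\dots,n\}$. For a family $\mathcal F\subseteq 2^{[n]}$ write $S(\mathcal F)=\{|A| : A\in\mathcal F\}$ and $\mathcal F_t=\{A\in\mathcal F : |A|=t\}$ for $t=0,1,\dots,n$. Given an integer $r\ge 1$, $\mathcal F$ is called an $r$-multiplicity antichain if (i) $A\not\subseteq B$ for all distinct $A,B\in\mathcal F$, and (ii) $|\mathcal F_t|\ge r$ for every $t\in S(\mathcal F)$. For integers $n,r\ge 1$ define $$g(n,r)=\max\{|S(\mathcal F)| : \mathcal F\subseteq 2^{[n]} \text{ is an } r\text{-multiplicity antichain}\}.$$ For an integer $r\ge 2$, $n_0(r)$ denotes the smallest integer $n_0$ such that $g(n,r)=n-3$ for every integer $n>n_0$. *)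

theory Defs
  imports Main
begin

definition sizes :: "nat set set \<Rightarrow> nat set" where
  "sizes F = {card A | A. A \<in> F}"

definition level :: "nat set set \<Rightarrow> nat \<Rightarrow> nat set set" where
  "level F t = {A \<in> F. card A = t}"

text \<open>The ground set is \<open>{1..n}\<close>, so all members are finite and \<open>card\<close> is their
  true cardinality.\<close>

definition multiplicity_antichain :: "nat \<Rightarrow> nat \<Rightarrow> nat set set \<Rightarrow> bool" where
  "multiplicity_antichain n r F \<longleftrightarrow>
     F \<subseteq> Pow {1..n} \<and>
     (\<forall>A\<in>F. \<forall>B\<in>F. A \<noteq> B \<longrightarrow> \<not> A \<subseteq> B) \<and>
     (\<forall>t\<in>sizes F. card (level F t) \<ge> r)"

text \<open>The maximum is over a finite set, which is nonempty because the empty family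
  qualifies.\<close>

definition g :: "nat \<Rightarrow> nat \<Rightarrow> nat" where
  "g n r = Max {card (sizes F) | F. multiplicity_antichain n r F}"

text \<open>The function \<open>g\<close> concerns ground sets with \<open>n \<ge> 1\<close>, so thresholds range over the
  natural numbers and \<open>n > m\<close> entails \<open>n \<ge> 1\<close>. The equation is stated in the integers to
  avoid truncated subtraction for \<open>n < 3\<close>.\<close>

definition n\<^sub>0 :: "nat \<Rightarrow> nat" where
  "n\<^sub>0 r = (LEAST m. \<forall>n>m. int (g n r) = int n - 3)"

end

theory Submission
  imports Defs
begin

text \<open>Upper bound: the sizes \<open>0\<close> and \<open>n\<close> cannot occur twice. If two singletons \<open>{a}\<close>, \<open>{b}\<close> occur,
  every larger member avoids \<open>a\<close> and \<open>b\<close>, so it has at most \<open>n - 2\<close> elements, and only one set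
  has exactly \<open>n - 2\<close>; dually for two members of size \<open>n - 1\<close>. In every case the sizes lie in an
  interval of length \<open>n - 3\<close>.

  Lower bound: families realising all sizes \<open>2, \<dots>, n - 2\<close> are built by induction in steps of
  three. Given such a family on \<open>{1..m}\<close> and new points \<open>a, b, c\<close>, add \<open>a\<close> to all its members
  (sizes \<open>3, \<dots>, m - 1\<close>) and adjoin \<open>{a, b}\<close>, \<open>{a, c}\<close> together with the complements of
  \<open>{a, 1}\<close>, \<open>{a, 2}\<close> (size \<open>m + 1\<close>) and of \<open>{a, b, 3}\<close>, \<open>{a, c, 3}\<close> (size \<open>m\<close>).\<close>

section \<open>Multiplicity two as the existence of two distinct members\<close>

lemma level_card_ge_2_iff:
  assumes "F \<subseteq> Pow {1..n}"
  shows "2 \<le> card (level F t) \<longleftrightarrow> (\<exists>A\<in>F. \<exists>B\<in>F. A \<noteq> B \<and> card A = t \<and> card B = t)"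
proof -
  have "finite (level F t)"
    by (rule finite_subset[of _ "Pow {1..n}"]) (use assms in \<open>auto simp: level_def\<close>)
  then have "card (level F t) \<le> Suc 0 \<longleftrightarrow> (\<forall>A\<in>level F t. \<forall>B\<in>level F t. A = B)"
    by (rule card_le_Suc0_iff_eq)
  moreover have "2 \<le> card (level F t) \<longleftrightarrow> \<not> card (level F t) \<le> Suc 0"
    by linarith
  ultimately show ?thesis
    by (auto simp: level_def)
qed

text \<open>Trades the cardinality of a level for two explicit witnesses. In this form the
  simplifier can check small concrete families, and witnesses can be exhibited directly in the
  inductive construction.\<close>

lemma multiplicity_antichain_2_iff:
  "multiplicity_antichain n 2 F \<longleftrightarrow>
     F \<subseteq> Pow {1..n} \<and> (\<forall>A\<in>F. \<forall>B\<in>F. A \<noteq> B \<longrightarrow> \<not> A \<subseteq> B) \<and>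
     (\<forall>t\<in>sizes F. \<exists>A\<in>F. \<exists>B\<in>F. A \<noteq> B \<and> card A = t \<and> card B = t)"
proof (cases "F \<subseteq> Pow {1..n}")
  case True
  show ?thesis
    unfolding multiplicity_antichain_def level_card_ge_2_iff[OF True] ..
next
  case False
  then show ?thesis
    unfolding multiplicity_antichain_def by (simp only: simp_thms)
qed

lemma two_members_of_size:
  assumes "multiplicity_antichain n 2 F" "t \<in> sizes F"
  obtains A B where "A \<in> F" "B \<in> F" "A \<noteq> B" "card A = t" "card B = t"
proof -
  have "\<forall>t\<in>sizes F. \<exists>A\<in>F. \<exists>B\<in>F. A \<noteq> B \<and> card A = t \<and> card B = t"
    using assms(1) unfolding multiplicity_antichain_2_iff by (elim conjE)
  then show thesis
    using assms(2) that by blast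
qed

lemma members_subset:
  assumes "multiplicity_antichain n r F" "A \<in> F"
  shows "A \<subseteq> {1..n}"
proof -
  have "F \<subseteq> Pow {1..n}"
    using assms(1) unfolding multiplicity_antichain_def by (elim conjE)
  then show ?thesis
    using assms(2) by blast
qed

lemma members_incomparable:
  assumes "multiplicity_antichain n r F" "A \<in> F" "B \<in> F" "A \<noteq> B"
  shows "\<not> A \<subseteq> B"
proof -
  have "\<forall>A\<in>F. \<forall>B\<in>F. A \<noteq> B \<longrightarrow> \<not> A \<subseteq> B"
    using assms(1) unfolding multiplicity_antichain_def by (elim conjE)
  then show ?thesis
    using assms(2-4) by blast
qed

section \<open>Upper bound on the number of sizes\<close>

lemma sizes_bounds:
  assumes "multiplicity_antichain n 2 F" "t \<in> sizes F"
  shows "1 \<le> t \<and> t < n"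
proof -
  obtain A B where AB: "A \<in> F" "B \<in> F" "A \<noteq> B" "card A = t" "card B = t"
    by (rule two_members_of_size[OF assms])
  have sub: "A \<subseteq> {1..n}" "B \<subseteq> {1..n}"
    using members_subset[OF assms(1)] AB by blast+
  then have fin: "finite A" "finite B"
    by (auto intro: finite_subset)
  have "t \<noteq> 0"
    using AB fin by auto
  moreover have "t \<le> n"
    using card_mono[OF _ sub(1)] AB by simp
  moreover have "t \<noteq> n"
    using card_subset_eq[OF _ sub(1)] card_subset_eq[OF _ sub(2)] AB by auto
  ultimately show ?thesis by linarith
qed

text \<open>A member other than the two singletons contains neither of their points, so it lies in a
  fixed set of \<open>n - 2\<close> elements. A size above \<open>n - 3\<close> would force it to be
  that whole set, which leaves room for only one such member.\<close>

lemma sizes_le_if_1_mem: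
  assumes F: "multiplicity_antichain n 2 F" and n: "4 \<le> n"
    and 1: "1 \<in> sizes F" and t: "t \<in> sizes F"
  shows "t \<le> n - 3"
proof (rule ccontr)
  assume big: "\<not> t \<le> n - 3"
  obtain A B where AB: "A \<in> F" "B \<in> F" "A \<noteq> B" "card A = 1" "card B = 1"
    by (rule two_members_of_size[OF F 1])
  obtain a b where ab: "A = {a}" "B = {b}"
    using AB by (auto simp: card_1_singleton_iff)
  obtain C D where CD: "C \<in> F" "D \<in> F" "C \<noteq> D" "card C = t" "card D = t"
    by (rule two_members_of_size[OF F t])
  have sub: "X \<subseteq> {1..n}" if "X \<in> F" for X
    using members_subset[OF F that] .
  have anti: "\<not> X \<subseteq> Y" if "X \<in> F" "Y \<in> F" "X \<noteq> Y" for X Y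
    using members_incomparable[OF F that] .
  let ?R = "{1..n} - {a, b}"
  have "{a, b} \<subseteq> {1..n}" "a \<noteq> b"
    using sub[OF AB(1)] sub[OF AB(2)] AB(3) ab by auto
  then have cR: "card ?R = n - 2"
    by (simp add: card_Diff_subset)
  have eqR: "X = ?R" if X: "X \<in> F" "card X = t" for X
  proof (cases "X = A \<or> X = B")
    \<comment> \<open>Impossible: here \<open>t = 1\<close>, but \<open>t\<close> exceeds
      \<open>n - 3\<close>, which is at least 1 because \<open>4 \<le> n\<close>.\<close>
    case True
    then show ?thesis using X AB big n by auto
  next
    case False
    then have "X \<subseteq> ?R"
      using anti[of A X] anti[of B X] sub X AB ab by auto
    moreover have "card X \<ge> card ?R"
      using X big cR by linarith
    ultimately show ?thesis
      by (intro card_seteq) auto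
  qed
  show False
    using eqR CD by blast
qed

text \<open>Dual argument: members of size \<open>n - 1\<close> are complements of points
  \<open>a\<close> and \<open>b\<close>, and any other member escapes both only by containing
  \<open>a\<close> and \<open>b\<close>. With at most two elements it must equal
  \<open>{a, b}\<close>, so its size cannot occur twice.\<close>

lemma sizes_ge_if_pred_mem:
  assumes F: "multiplicity_antichain n 2 F" and n: "4 \<le> n"
    and n1: "n - 1 \<in> sizes F" and t: "t \<in> sizes F"
  shows "3 \<le> t"
proof (rule ccontr)
  assume small: "\<not> 3 \<le> t"
  obtain A B where AB: "A \<in> F" "B \<in> F" "A \<noteq> B" "card A = n - 1" "card B = n - 1"
    by (rule two_members_of_size[OF F n1])
  obtain C D where CD: "C \<in> F" "D \<in> F" "C \<noteq> D" "card C = t" "card D = t"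
    by (rule two_members_of_size[OF F t])
  have sub: "X \<subseteq> {1..n}" if "X \<in> F" for X
    using members_subset[OF F that] .
  have anti: "\<not> X \<subseteq> Y" if "X \<in> F" "Y \<in> F" "X \<noteq> Y" for X Y
    using members_incomparable[OF F that] .
  have co: "\<exists>x. X = {1..n} - {x}" if "X \<in> F" "card X = n - 1" for X
  proof -
    have "card ({1..n} - X) = 1"
      using that sub[of X] n by (subst card_Diff_subset) (auto intro: finite_subset)
    then obtain x where "{1..n} - X = {x}"
      by (auto simp: card_1_singleton_iff)
    then show ?thesis
      using sub[OF that(1)] by blast
  qed
  obtain a b where ab: "A = {1..n} - {a}" "B = {1..n} - {b}"
    using co AB by metis
  have "a \<noteq> b"
    using ab AB by auto
  have eqab: "X = {a, b}" if X: "X \<in> F" "card X = t" for X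
  proof -
    \<comment> \<open>The sizes differ: \<open>t \<le> 2 < n - 1\<close>, by
      \<open>4 \<le> n\<close>.\<close>
    have "X \<noteq> A" "X \<noteq> B"
      using X AB small n by auto
    then have "{a, b} \<subseteq> X"
      using anti[of X A] anti[of X B] sub[of X] X AB ab by auto
    moreover have "card X \<le> card {a, b}"
      using X small \<open>a \<noteq> b\<close> by simp
    moreover have "finite X"
      using sub[OF X(1)] by (rule finite_subset) simp
    ultimately show ?thesis
      using card_seteq by metis
  qed
  show False
    using eqab CD by blast
qed

lemma card_sizes_le:
  assumes F: "multiplicity_antichain n 2 F" and n: "4 \<le> n"
  shows "card (sizes F) \<le> n - 3"
proof -
  have bd: "1 \<le> t \<and> t < n" if "t \<in> sizes F" for t
    using sizes_bounds F that by blast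
  consider "1 \<in> sizes F" | "n - 1 \<in> sizes F" | "1 \<notin> sizes F" "n - 1 \<notin> sizes F"
    by blast
  \<comment> \<open>The expression \<open>u + 1 - l\<close> is the cardinality of
    \<open>{l..u}\<close>. The intervals are \<open>{1..n - 3}\<close>, \<open>{3..n - 1}\<close>
    and \<open>{2..n - 2}\<close> in the three cases.\<close>
  then obtain l u where "sizes F \<subseteq> {l..u}" "u + 1 - l = n - 3"
  proof cases
    case 1
    then have "sizes F \<subseteq> {1..n - 3}"
      using sizes_le_if_1_mem[OF F n] bd by force
    then show ?thesis using that by fastforce
  next
    case 2
    then have "sizes F \<subseteq> {3..n - 1}"
      using sizes_ge_if_pred_mem[OF F n] bd by force
    then show ?thesis using that[of 3 "n - 1"] n by simp
  next
    case 3
    have "sizes F \<subseteq> {2..n - 2}"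
    proof
      fix t assume t: "t \<in> sizes F"
      then have "t \<noteq> 1" "t \<noteq> n - 1"
        using 3 by auto
      then show "t \<in> {2..n - 2}"
        using bd[OF t] by auto
    qed
    then show ?thesis using that[of 2 "n - 2"] n by simp
  qed
  then show ?thesis
    using card_mono[of "{l..u}" "sizes F"] by simp
qed

section \<open>Construction of families with all middle sizes\<close>

lemma antichain_step:
  assumes F: "multiplicity_antichain m 2 F" and S: "sizes F = {2..m - 2}" and m: "3 \<le> m"
  shows "\<exists>G. multiplicity_antichain (m + 3) 2 G \<and> sizes G = {2..m + 1}"
proof -
  \<comment> \<open>Three fresh points; by \<open>3 \<le> m\<close> the points 1, 2, 3 used below
    are old ones.\<close>
  define a b c where abc: "a = m + 1" "b = m + 2" "c = m + 3"
  let ?U = "{1..m + 3}"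
  let ?P1 = "{a, b}" and ?P2 = "{a, c}"
    and ?Q1 = "?U - {a, 1}" and ?Q2 = "?U - {a, 2}"
    and ?R1 = "?U - {a, b, 3}" and ?R2 = "?U - {a, c, 3}"
  \<comment> \<open>Inserting \<open>a\<close> shifts the old sizes to \<open>{3..m - 1}\<close>;
    the missing sizes 2, \<open>m + 1\<close> and \<open>m\<close> come from \<open>P\<close>,
    \<open>Q\<close> and \<open>R\<close> respectively.\<close>
  define P Q R where PQR: "P = {?P1, ?P2}" "Q = {?Q1, ?Q2}" "R = {?R1, ?R2}"
  define N where "N = P \<union> Q \<union> R"
  define G where "G = insert a ` F \<union> N"
  have sub: "A \<subseteq> {1..m}" if "A \<in> F" for A
    using members_subset[OF F that] .
  have fin: "finite A" if "A \<in> F" for A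
    using sub[OF that] by (rule finite_subset) simp
  have new: "a \<notin> A" "b \<notin> A" "c \<notin> A" if "A \<in> F" for A
    using sub[OF that] abc by auto
  have anti: "\<not> A \<subseteq> B" if "A \<in> F" "B \<in> F" "A \<noteq> B" for A B
    using members_incomparable[OF F that] .
  have two: "\<exists>A\<in>F. \<exists>B\<in>F. A \<noteq> B \<and> card A = t \<and> card B = t" if "t \<in> {2..m - 2}" for t
    using two_members_of_size[OF F, of t] S that by metis
  have cF: "card (insert a A) = Suc (card A)" if "A \<in> F" for A
    using new fin that by simp
  have cP: "card ?P1 = 2" "card ?P2 = 2"
    using abc by auto
  have cQ: "card ?Q1 = m + 1" "card ?Q2 = m + 1"
    using abc m by (auto simp: card_Diff_subset)
  have cR: "card ?R1 = m" "card ?R2 = m"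
    using abc m by (auto simp: card_Diff_subset)
  have cardN: "Z \<in> P \<Longrightarrow> card Z = 2" "Z \<in> Q \<Longrightarrow> card Z = m + 1" "Z \<in> R \<Longrightarrow> card Z = m" for Z
    using cP cQ cR unfolding PQR by (metis insertE singletonD)+
  have inU: "a \<in> ?U" "b \<in> ?U" "c \<in> ?U" "1 \<in> ?U" "2 \<in> ?U" "3 \<in> ?U"
    using abc m by auto
  have dist: "a \<noteq> b" "a \<noteq> c" "b \<noteq> c" "a > 3" "b > 3" "c > 3"
    using abc m by auto
  have neq: "?P1 \<noteq> ?P2" "?Q1 \<noteq> ?Q2" "?R1 \<noteq> ?R2"
  proof -
    show "?P1 \<noteq> ?P2" using dist by auto
    have "2 \<in> ?Q1" "2 \<notin> ?Q2" using inU dist by auto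
    then show "?Q1 \<noteq> ?Q2" by metis
    have "c \<in> ?R1" "c \<notin> ?R2" using inU dist by auto
    then show "?R1 \<noteq> ?R2" by metis
  qed
  have "\<not> X \<subseteq> Y" if XY: "X \<in> G" "Y \<in> G" "X \<noteq> Y" for X Y
  proof -
    have old_new: "\<not> insert a A \<subseteq> Z \<and> \<not> Z \<subseteq> insert a A"
      if "A \<in> F" "Z \<in> N" for A Z
    proof -
      \<comment> \<open>Every adjoined set meets \<open>{b, c}\<close>, while an extended old member
        contains neither point.\<close>
      have "\<exists>z\<in>Z. z \<in> {b, c}"
        using that(2) inU dist by (auto simp: N_def PQR)
      then have "\<not> Z \<subseteq> insert a A"
        using new[OF that(1)] dist by auto
      moreover have "\<not> insert a A \<subseteq> Z"
      proof (cases "Z = ?P1 \<or> Z = ?P2")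
        case True
        \<comment> \<open>A nonempty \<open>A\<close> has an old point, which is in neither pair of
          \<open>P\<close>. The sets of \<open>Q\<close> and \<open>R\<close> omit \<open>a\<close>,
          which settles the other case.\<close>
        have "card A \<in> {2..m - 2}"
          using S that(1) by (auto simp: sizes_def)
        then have "A \<noteq> {}" by auto
        then show ?thesis
          using True new[OF that(1)] by auto
      next
        case False
        then show ?thesis using that(2) by (auto simp: N_def PQR)
      qed
      ultimately show ?thesis by blast
    qed
    have new_new: "\<not> X \<subseteq> Y"
      if XYN: "X \<in> N" "Y \<in> N"
    proof
      assume "X \<subseteq> Y"
      moreover have "finite Y"
        using that(2) by (auto simp: N_def PQR)
      \<comment> \<open>Proper inclusion strictly raises the size, and \<open>2 < m < m + 1\<close>,
        so only \<open>P\<close> below \<open>Q\<close> or \<open>R\<close>, and \<open>R\<close>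
        below \<open>Q\<close>, remain to be excluded.\<close>
      ultimately have less: "card X < card Y"
        using \<open>X \<noteq> Y\<close> by (simp add: psubset_card_mono psubset_eq)
      consider "X \<in> P" "Y \<in> Q \<union> R" | "X \<in> R" "Y \<in> Q"
        using XYN less cardN[of X] cardN[of Y] m unfolding N_def by (elim UnE) auto
      then show False
      proof cases
        case 1
        then have "a \<in> X" "a \<notin> Y" by (auto simp: PQR)
        then show False using \<open>X \<subseteq> Y\<close> by blast
      next
        case 2
        \<comment> \<open>This is why \<open>R\<close> omits the third old point 3: its sets keep 1
          and 2, one of which is missing from each set of \<open>Q\<close>.\<close>
        then have "1 \<in> X" "2 \<in> X" "1 \<notin> Y \<or> 2 \<notin> Y"
          using inU dist by (auto simp: PQR)
        then show False using \<open>X \<subseteq> Y\<close> by blast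
      qed
    qed
    consider A B where "A \<in> F" "B \<in> F" "X = insert a A" "Y = insert a B"
      | A where "A \<in> F" "X = insert a A" "Y \<in> N"
      | A where "A \<in> F" "Y = insert a A" "X \<in> N"
      | "X \<in> N" "Y \<in> N"
      using XY(1,2) unfolding G_def by blast
    then show ?thesis
    proof cases
      case 1
      then have "\<not> A \<subseteq> B"
        using anti XY(3) by blast
      then show ?thesis
        using 1 new(1) by auto
    next
      case 2
      then show ?thesis using old_new by simp
    next
      case 3
      then show ?thesis using old_new by simp
    next
      case 4
      then show ?thesis using new_new by simp
    qed
  qed
  moreover have "G \<subseteq> Pow ?U"
    using sub abc unfolding G_def N_def PQR by fastforce
  moreover have two_G: "\<exists>X\<in>G. \<exists>Y\<in>G. X \<noteq> Y \<and> card X = t \<and> card Y = t" if t: "t \<in> {2..m + 1}" for t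
  proof -
    consider "t = 2" | "t = m + 1" | "t = m" | "t - 1 \<in> {2..m - 2}"
      using t by fastforce
    then show ?thesis
    proof cases
      case 1
      have "?P1 \<in> G" "?P2 \<in> G" by (simp_all add: G_def N_def PQR)
      with 1 cP neq show ?thesis by metis
    next
      case 2
      have "?Q1 \<in> G" "?Q2 \<in> G" by (simp_all add: G_def N_def PQR)
      with 2 cQ neq show ?thesis by metis
    next
      case 3
      have "?R1 \<in> G" "?R2 \<in> G" by (simp_all add: G_def N_def PQR)
      with 3 cR neq show ?thesis by metis
    next
      case 4
      then obtain A B where AB: "A \<in> F" "B \<in> F" "A \<noteq> B" "card A = t - 1" "card B = t - 1"
        using two by blast
      have "insert a A \<in> G" "insert a B \<in> G"
        using AB by (auto simp: G_def)
      moreover have "insert a A \<noteq> insert a B"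
        using AB new(1) by (metis insert_ident)
      moreover have "card (insert a A) = t" "card (insert a B) = t"
        using AB cF t by simp_all
      ultimately show ?thesis by metis
    qed
  qed
  moreover have "sizes G = {2..m + 1}"
  proof
    show "{2..m + 1} \<subseteq> sizes G"
    proof
      fix t assume "t \<in> {2..m + 1}"
      then obtain X where "X \<in> G" "card X = t"
        using two_G by metis
      then show "t \<in> sizes G"
        by (auto simp: sizes_def)
    qed
    show "sizes G \<subseteq> {2..m + 1}"
    proof
      fix t assume "t \<in> sizes G"
      then obtain X where X: "X \<in> G" "t = card X"
        by (auto simp: sizes_def)
      show "t \<in> {2..m + 1}"
      proof (cases "X \<in> insert a ` F")
        case True
        then obtain A where A: "A \<in> F" "X = insert a A" by blast
        then have "card A \<in> {2..m - 2}"
          using S by (auto simp: sizes_def)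
        then show ?thesis using A X cF by auto
      next
        case False
        then have "card X \<in> {2, m + 1, m}"
          using X(1) cardN unfolding G_def N_def by blast
        then show ?thesis using X m by auto
      qed
    qed
  qed
  ultimately show ?thesis
    by (intro exI[of _ G]) (simp add: multiplicity_antichain_2_iff)
qed

lemma sizes_insert: "sizes (insert A F) = insert (card A) (sizes F)"
  by (auto simp: sizes_def)

lemma sizes_empty: "sizes {} = {}"
  by (simp add: sizes_def)

text \<open>Since the step adds three points, the induction needs the three base cases 3, 4 and
  5.\<close>

lemma exists_antichain:
  assumes "3 \<le> n"
  shows "\<exists>F. multiplicity_antichain n 2 F \<and> sizes F = {2..n - 2}"
  using assms
proof (induction n rule: less_induct)
  case (less n)
  consider "n = 3" | "n = 4" | "n = 5" | "6 \<le> n"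
    using less.prems by linarith
  then show ?case
  proof cases
    case 1
    \<comment> \<open>For \<open>n = 3\<close> the interval \<open>{2..1}\<close> is empty, so the
      empty family serves.\<close>
    have "multiplicity_antichain 3 2 {}"
      by (simp add: multiplicity_antichain_2_iff sizes_empty)
    with 1 show ?thesis
      by (intro exI[of _ "{}"]) (simp add: sizes_empty)
  next
    case 2
    have "{1, 2} \<noteq> {1, 3 :: nat}" by auto
    then have "multiplicity_antichain 4 2 {{1, 2}, {1, 3}}"
      by (simp add: multiplicity_antichain_2_iff sizes_insert sizes_empty)
    with 2 show ?thesis
      by (intro exI[of _ "{{1, 2}, {1, 3}}"]) (simp add: sizes_insert sizes_empty)
  next
    case 3
    \<comment> \<open>Both pairs contain 1 and both triples omit it, so no pair lies in a
      triple.\<close>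
    have "{1, 2} \<noteq> {1, 3 :: nat}" "{2, 3, 4} \<noteq> {2, 3, 5 :: nat}"
      by (simp_all add: set_eq_subset)
    then have "multiplicity_antichain 5 2 {{1, 2}, {1, 3}, {2, 3, 4}, {2, 3, 5}}"
      by (simp add: multiplicity_antichain_2_iff sizes_insert sizes_empty)
    with 3 show ?thesis
      by (intro exI[of _ "{{1, 2}, {1, 3}, {2, 3, 4}, {2, 3, 5}}"])
        (auto simp: sizes_insert sizes_empty)
  next
    case 4
    then obtain F where "multiplicity_antichain (n - 3) 2 F" "sizes F = {2..n - 3 - 2}"
      using less.IH[of "n - 3"] by force
    then have "\<exists>G. multiplicity_antichain (n - 3 + 3) 2 G \<and> sizes G = {2..n - 3 + 1}"
      by (rule antichain_step) (use 4 in simp)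
    moreover have "n - 3 + 3 = n" "n - 3 + 1 = n - 2"
      using 4 by auto
    ultimately show ?thesis by simp
  qed
qed

section \<open>The values of \<open>g\<close> and the threshold\<close>

lemma finite_card_sizes: "finite {card (sizes F) | F. multiplicity_antichain n r F}"
proof (rule finite_subset)
  show "{card (sizes F) | F. multiplicity_antichain n r F}
      \<subseteq> (\<lambda>F. card (sizes F)) ` Pow (Pow {1..n})"
    by (auto simp: multiplicity_antichain_def)
qed simp

lemma g_2_eq:
  assumes "4 \<le> n"
  shows "g n 2 = n - 3"
  unfolding g_def
proof (rule Max_eqI[OF finite_card_sizes])
  show "y \<le> n - 3" if "y \<in> {card (sizes F) | F. multiplicity_antichain n 2 F}" for y
    using that card_sizes_le assms by blast
  obtain F where "multiplicity_antichain n 2 F" "sizes F = {2..n - 2}"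
    using exists_antichain[of n] assms by auto
  moreover have "card {2..n - 2} = n - 3"
    using assms by simp
  ultimately show "n - 3 \<in> {card (sizes F) | F. multiplicity_antichain n 2 F}"
    by (metis (mono_tags, lifting) mem_Collect_eq)
qed

text \<open>At \<open>n = 3\<close> two singletons already realise one size, whereas
  \<open>n - 3 = 0\<close>. The formula therefore fails there, which rules out every threshold below
  3.\<close>

lemma g_3_2_pos: "0 < g 3 2"
proof -
  let ?F = "{{1}, {2}} :: nat set set"
  have "multiplicity_antichain 3 2 ?F"
    by (simp add: multiplicity_antichain_2_iff sizes_insert sizes_empty)
  moreover have "card (sizes ?F) = 1"
    by (simp add: sizes_insert sizes_empty)
  ultimately have "1 \<in> {card (sizes F) | F. multiplicity_antichain 3 2 F}"
    by force
  then have "1 \<le> g 3 2"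
    unfolding g_def by (rule Max_ge[OF finite_card_sizes])
  then show ?thesis by simp
qed

theorem theoremA2: "n\<^sub>0 2 = 3"
  unfolding n\<^sub>0_def
proof (rule Least_equality)
  show "\<forall>n>3. int (g n 2) = int n - 3"
    by (simp add: g_2_eq)
  show "3 \<le> m" if "\<forall>n>m. int (g n 2) = int n - 3" for m
  proof (rule ccontr)
    assume "\<not> 3 \<le> m"
    \<comment> \<open>For \<open>m < 3\<close> the assumed formula applies to
      \<open>n = 3\<close>.\<close>
    then have "int (g 3 2) = 0"
      using that by simp
    then show False
      using g_3_2_pos by simp
  qed
qed

end
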